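(* Over a field of characteristic $0$, every multilinear polynomial identity of degree $5$ satisfied by the special translator $\langle x,y,z\rangle=xyz-yzx$ in every associative triple system follows from $\langle x,y,z\rangle+\langle y,z,x\rangle+\langle z,x,y\rangle=0$ and $$R_{y,z}(\langle v,w,x\rangle)=\langle R_{y,z}(v),w,x\rangle+\langle v,R_{y,z}(w),x\rangle+\langle v,w,R_{y,z}(x)\rangle,$$ where $R_{y,z}(u)=\langle u,y,z\rangle$.
   Context: An associative triple system is a vector space $A$ with a trilinear operation $(x,y,z)\mapsto xyz$ satisfying $((vwx)yz)=(v(wxy)z)=(vw(xyz))$. Multilinear identities of degree $n$ are elements of the multilinear part of degree $n$ (on $n$ distinct variables) of the free algebra with one trilinear operation $\langle -,-,-\rangle$ with no symmetry; such an element is an identity satisfied by the special translator if it becomes $0$ when $\langle x,y,z\rangle$ is replaced by $xyz-yzx$ in every associative triple system. An identity follows from a set of identities if it belongs to the operadic ideal they generate, i.e. it is a linear combination of identities obtained from the given ones by permuting variables, substituting monomials for variables, and inserting the identities as arguments into the operation. *)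

theory Defs
  imports Complex_Main "HOL-Library.Poly_Mapping"
begin

locale assoc_triple_system = vector_space scale
  for scale :: "'k::field \<Rightarrow> 'v::ab_group_add \<Rightarrow> 'v" +
  fixes tp :: "'v \<Rightarrow> 'v \<Rightarrow> 'v \<Rightarrow> 'v"
  assumes linear_1: "Vector_Spaces.linear scale scale (\<lambda>x. tp x y z)"
    and linear_2: "Vector_Spaces.linear scale scale (\<lambda>y. tp x y z)"
    and linear_3: "Vector_Spaces.linear scale scale (\<lambda>z. tp x y z)"
    and assoc_12: "tp (tp v w x) y z = tp v (tp w x y) z"
    and assoc_23: "tp v (tp w x y) z = tp v w (tp x y z)"

definition special_translator ::
    "('v::ab_group_add \<Rightarrow> 'v \<Rightarrow> 'v \<Rightarrow> 'v) \<Rightarrow> 'v \<Rightarrow> 'v \<Rightarrow> 'v \<Rightarrow> 'v" where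
  "special_translator tp x y z = tp x y z - tp y z x"

datatype monomial = Var nat | Op monomial monomial monomial

type_synonym 'k free_alg = "monomial \<Rightarrow>\<^sub>0 'k"

definition pm_scale :: "'k::field \<Rightarrow> ('a \<Rightarrow>\<^sub>0 'k) \<Rightarrow> ('a \<Rightarrow>\<^sub>0 'k)" where
  "pm_scale c f = Poly_Mapping.map (\<lambda>a. c * a) f"

definition lin_ext :: "('k::field \<Rightarrow> 'v::ab_group_add \<Rightarrow> 'v) \<Rightarrow> ('a \<Rightarrow> 'v) \<Rightarrow> ('a \<Rightarrow>\<^sub>0 'k) \<Rightarrow> 'v" where
  "lin_ext scale h f = (\<Sum>t\<in>Poly_Mapping.keys f. scale (Poly_Mapping.lookup f t) (h t))"

definition trilin_ext :: "('a \<Rightarrow> 'a \<Rightarrow> 'a \<Rightarrow> 'a) \<Rightarrow>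
    ('a \<Rightarrow>\<^sub>0 'k::field) \<Rightarrow> ('a \<Rightarrow>\<^sub>0 'k) \<Rightarrow> ('a \<Rightarrow>\<^sub>0 'k) \<Rightarrow> ('a \<Rightarrow>\<^sub>0 'k)" where
  "trilin_ext m f g h =
     lin_ext pm_scale (\<lambda>s. lin_ext pm_scale (\<lambda>t. lin_ext pm_scale (\<lambda>u.
       Poly_Mapping.single (m s t u) 1) h) g) f"

definition br :: "'k::field free_alg \<Rightarrow> 'k free_alg \<Rightarrow> 'k free_alg \<Rightarrow> 'k free_alg" where
  "br = trilin_ext Op"

definition mon :: "monomial \<Rightarrow> 'k::field free_alg" where
  "mon t = Poly_Mapping.single t 1"

primrec vars :: "monomial \<Rightarrow> nat list" where
  "vars (Var i) = [i]"
| "vars (Op s t u) = vars s @ vars t @ vars u"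

definition multilinear_monomial :: "nat set \<Rightarrow> monomial \<Rightarrow> bool" where
  "multilinear_monomial X t \<longleftrightarrow> distinct (vars t) \<and> set (vars t) = X"

definition multilinear :: "nat set \<Rightarrow> 'k::field free_alg \<Rightarrow> bool" where
  "multilinear X f \<longleftrightarrow> (\<forall>t\<in>Poly_Mapping.keys f. multilinear_monomial X t)"

primrec subst_monomial :: "(nat \<Rightarrow> monomial) \<Rightarrow> monomial \<Rightarrow> monomial" where
  "subst_monomial \<sigma> (Var i) = \<sigma> i"
| "subst_monomial \<sigma> (Op s t u) =
     Op (subst_monomial \<sigma> s) (subst_monomial \<sigma> t) (subst_monomial \<sigma> u)"

definition subst :: "(nat \<Rightarrow> monomial) \<Rightarrow> 'k::field free_alg \<Rightarrow> 'k free_alg" where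
  "subst \<sigma> = lin_ext pm_scale (\<lambda>t. mon (subst_monomial \<sigma> t))"

primrec eval_monomial :: "('v \<Rightarrow> 'v \<Rightarrow> 'v \<Rightarrow> 'v) \<Rightarrow> (nat \<Rightarrow> 'v) \<Rightarrow> monomial \<Rightarrow> 'v" where
  "eval_monomial q \<rho> (Var i) = \<rho> i"
| "eval_monomial q \<rho> (Op s t u) =
     q (eval_monomial q \<rho> s) (eval_monomial q \<rho> t) (eval_monomial q \<rho> u)"

definition eval_alg :: "('k::field \<Rightarrow> 'v::ab_group_add \<Rightarrow> 'v) \<Rightarrow> ('v \<Rightarrow> 'v \<Rightarrow> 'v \<Rightarrow> 'v) \<Rightarrow>
    (nat \<Rightarrow> 'v) \<Rightarrow> 'k free_alg \<Rightarrow> 'v" where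
  "eval_alg scale q \<rho> = lin_ext scale (eval_monomial q \<rho>)"

definition translator_identity_on :: "'v::ab_group_add itself \<Rightarrow> 'k::field free_alg \<Rightarrow> bool" where
  "translator_identity_on (_ :: 'v itself) f \<longleftrightarrow>
     (\<forall>(scale :: 'k \<Rightarrow> 'v \<Rightarrow> 'v) tp. assoc_triple_system scale tp \<longrightarrow>
        (\<forall>\<rho>. eval_alg scale (special_translator tp) \<rho> f = 0))"

text \<open>HOL cannot quantify over all types \<open>'v\<close> inside a formula. The type
  \<open>nat list \<Rightarrow>\<^sub>0 'k\<close> of linear combinations of words contains the free associative triple
  system on countably many generators, so testing on it amounts to testing on every associative
  triple system on every type; this is \<open>translator_identity_universal\<close> below.\<close>

definition translator_identity :: "'k::field free_alg \<Rightarrow> bool" where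
  "translator_identity f \<longleftrightarrow> translator_identity_on TYPE(nat list \<Rightarrow>\<^sub>0 'k) f"

text \<open>\<open>operadic_ideal G X f\<close>: the element \<open>f\<close>, multilinear in the finite variable set \<open>X\<close>, lies in
  the operadic ideal generated by \<open>G\<close>. The components of the ideal are indexed by finite sets of
  variables rather than by arities. Simultaneous substitution of multilinear monomials in
  pairwise disjoint variables covers both the renaming (in particular the permutation) of
  variables and the substitution of a monomial for one variable.\<close>

inductive operadic_ideal :: "'k::field free_alg set \<Rightarrow> nat set \<Rightarrow> 'k free_alg \<Rightarrow> bool"
  for G :: "'k free_alg set" where
  generator: "g \<in> G \<Longrightarrow> finite X \<Longrightarrow> multilinear X g \<Longrightarrow> operadic_ideal G X g"
| zero: "finite X \<Longrightarrow> operadic_ideal G X 0"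
| add: "operadic_ideal G X f \<Longrightarrow> operadic_ideal G X g \<Longrightarrow> operadic_ideal G X (f + g)"
| scale: "operadic_ideal G X f \<Longrightarrow> operadic_ideal G X (pm_scale c f)"
| subst: "operadic_ideal G X f \<Longrightarrow> (\<And>x. x \<in> X \<Longrightarrow> multilinear_monomial (Y x) (\<sigma> x)) \<Longrightarrow>
    (\<And>x x'. x \<in> X \<Longrightarrow> x' \<in> X \<Longrightarrow> x \<noteq> x' \<Longrightarrow> Y x \<inter> Y x' = {}) \<Longrightarrow>
    operadic_ideal G (\<Union>x\<in>X. Y x) (subst \<sigma> f)"
| insert_1: "operadic_ideal G X f \<Longrightarrow> multilinear_monomial Y s \<Longrightarrow> multilinear_monomial Z t \<Longrightarrow>
    X \<inter> Y = {} \<Longrightarrow> X \<inter> Z = {} \<Longrightarrow> Y \<inter> Z = {} \<Longrightarrow>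
    operadic_ideal G (X \<union> Y \<union> Z) (br f (mon s) (mon t))"
| insert_2: "operadic_ideal G X f \<Longrightarrow> multilinear_monomial Y s \<Longrightarrow> multilinear_monomial Z t \<Longrightarrow>
    X \<inter> Y = {} \<Longrightarrow> X \<inter> Z = {} \<Longrightarrow> Y \<inter> Z = {} \<Longrightarrow>
    operadic_ideal G (X \<union> Y \<union> Z) (br (mon s) f (mon t))"
| insert_3: "operadic_ideal G X f \<Longrightarrow> multilinear_monomial Y s \<Longrightarrow> multilinear_monomial Z t \<Longrightarrow>
    X \<inter> Y = {} \<Longrightarrow> X \<inter> Z = {} \<Longrightarrow> Y \<inter> Z = {} \<Longrightarrow>
    operadic_ideal G (X \<union> Y \<union> Z) (br (mon s) (mon t) f)"

definition cyclic_identity :: "'k::field free_alg" where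
  "cyclic_identity =
     (let x = mon (Var 0); y = mon (Var 1); z = mon (Var 2)
      in br x y z + br y z x + br z x y)"

definition derivation_identity :: "'k::field free_alg" where
  "derivation_identity =
     (let v = mon (Var 0); w = mon (Var 1); x = mon (Var 2);
          y = mon (Var 3); z = mon (Var 4); R = (\<lambda>u. br u y z)
      in R (br v w x) - (br (R v) w x + br v (R w) x + br v w (R x)))"

lemma lookup_pm_scale: "Poly_Mapping.lookup (pm_scale c f) t = c * Poly_Mapping.lookup f t"
  by (simp add: pm_scale_def Poly_Mapping.map.rep_eq when_def)

lemma keys_pm_scale: "Poly_Mapping.keys (pm_scale c f) \<subseteq> Poly_Mapping.keys f"
  by (auto simp: in_keys_iff lookup_pm_scale)

lemma vector_space_pm_scale: "vector_space pm_scale"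
  by unfold_locales
    (simp_all add: poly_mapping_eq_iff fun_eq_iff lookup_pm_scale lookup_add algebra_simps)

lemma lin_ext_superset:
  assumes "vector_space scale" "finite S" "Poly_Mapping.keys f \<subseteq> S"
  shows "lin_ext scale h f = (\<Sum>t\<in>S. scale (Poly_Mapping.lookup f t) (h t))"
proof -
  interpret vector_space scale by fact
  show ?thesis unfolding lin_ext_def
    by (rule sum.mono_neutral_left) (use assms in \<open>auto simp: in_keys_iff\<close>)
qed

lemma linear_lin_ext:
  assumes "vector_space scale"
  shows "Vector_Spaces.linear pm_scale scale (lin_ext scale h)"
proof -
  interpret vector_space scale by fact
  have add: "lin_ext scale h (f + g) = lin_ext scale h f + lin_ext scale h g" for f g
    using keys_add[of f g]
    by (simp add: lin_ext_superset[OF assms, of "Poly_Mapping.keys f \<union> Poly_Mapping.keys g"] lookup_add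
        scale_left_distrib sum.distrib)
  have "lin_ext scale h (pm_scale c f) = scale c (lin_ext scale h f)" for c f
    using lin_ext_superset[OF assms finite_keys keys_pm_scale]
    by (simp add: lin_ext_def lookup_pm_scale scale_sum_right)
  with add show ?thesis
    using vector_space_pm_scale assms
    by (auto simp: module_hom_iff_linear[symmetric] module_hom_iff module_iff_vector_space)
qed

lemma linear_of_lin_ext:
  assumes "Vector_Spaces.linear s1 s2 F"
  shows "F (lin_ext s1 h f) = lin_ext s2 (\<lambda>t. F (h t)) f"
proof -
  interpret F: Vector_Spaces.linear s1 s2 F by fact
  show ?thesis by (simp add: lin_ext_def F.sum F.scale)
qed

lemma lin_ext_single: "vector_space scale \<Longrightarrow> lin_ext scale h (Poly_Mapping.single t 1) = h t"
  by (simp add: lin_ext_def vector_space_def)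

lemma linear_pointwise_lin_ext:
  assumes "vector_space s1" "vector_space s2" "\<And>t. Vector_Spaces.linear s1 s2 (\<lambda>x. h x t)"
  shows "Vector_Spaces.linear s1 s2 (\<lambda>x. lin_ext s2 (h x) f)"
proof -
  interpret v: vector_space s2 by fact
  from assms show ?thesis
    by (auto simp: lin_ext_def module_hom_iff_linear[symmetric] module_hom_iff
        module_iff_vector_space sum.distrib v.scale_sum_right v.scale_right_distrib mult.commute)
qed

lemmas linear_pm_lin_ext = linear_lin_ext[OF vector_space_pm_scale]

lemma trilin_ext_linear:
  "Vector_Spaces.linear pm_scale pm_scale (\<lambda>f. trilin_ext m f g h)"
  "Vector_Spaces.linear pm_scale pm_scale (\<lambda>g. trilin_ext m f g h)"
  "Vector_Spaces.linear pm_scale pm_scale (\<lambda>h. trilin_ext m f g h)"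
  unfolding trilin_ext_def
  by (intro linear_pm_lin_ext linear_pointwise_lin_ext vector_space_pm_scale)+

lemma linear_trilin_ext:
  assumes "Vector_Spaces.linear pm_scale scale F"
  shows "F (trilin_ext m f g h) =
    lin_ext scale (\<lambda>s. lin_ext scale (\<lambda>t. lin_ext scale (\<lambda>u.
      F (Poly_Mapping.single (m s t u) 1)) h) g) f"
  unfolding trilin_ext_def by (simp add: linear_of_lin_ext[OF assms])

lemma trilin_ext_assoc:
  assumes "\<And>v w x y z. m (m v w x) y z = m v (m w x y) z"
    and "\<And>v w x y z. m v (m w x y) z = m v w (m x y z)"
  shows "trilin_ext m (trilin_ext m a b c) d e = trilin_ext m a (trilin_ext m b c d) e"
    and "trilin_ext m a (trilin_ext m b c d) e = trilin_ext m a b (trilin_ext m c d e)"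
proof -
  note simps = lin_ext_single[OF vector_space_pm_scale]
  have l: "trilin_ext m (trilin_ext m a b c) d e =
    lin_ext pm_scale (\<lambda>s. lin_ext pm_scale (\<lambda>t. lin_ext pm_scale (\<lambda>u.
    lin_ext pm_scale (\<lambda>v. lin_ext pm_scale (\<lambda>w.
      Poly_Mapping.single (m (m s t u) v w) 1) e) d) c) b) a"
    by (subst linear_trilin_ext[OF trilin_ext_linear(1)]) (simp add: trilin_ext_def simps)
  have c1: "trilin_ext m a (trilin_ext m b c d) e =
    lin_ext pm_scale (\<lambda>s. trilin_ext m (Poly_Mapping.single s 1) (trilin_ext m b c d) e) a"
    by (simp add: trilin_ext_def simps)
  have c: "trilin_ext m a (trilin_ext m b c d) e =
    lin_ext pm_scale (\<lambda>s. lin_ext pm_scale (\<lambda>t. lin_ext pm_scale (\<lambda>u.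
    lin_ext pm_scale (\<lambda>v. lin_ext pm_scale (\<lambda>w.
      Poly_Mapping.single (m s (m t u v) w) 1) e) d) c) b) a"
    unfolding c1
    by (subst linear_trilin_ext[OF trilin_ext_linear(2)]) (simp add: trilin_ext_def simps)
  have r1: "trilin_ext m a b (trilin_ext m c d e) =
    lin_ext pm_scale (\<lambda>s. lin_ext pm_scale (\<lambda>t.
      trilin_ext m (Poly_Mapping.single s 1) (Poly_Mapping.single t 1) (trilin_ext m c d e)) b) a"
    by (simp add: trilin_ext_def simps)
  have r: "trilin_ext m a b (trilin_ext m c d e) =
    lin_ext pm_scale (\<lambda>s. lin_ext pm_scale (\<lambda>t. lin_ext pm_scale (\<lambda>u.
    lin_ext pm_scale (\<lambda>v. lin_ext pm_scale (\<lambda>w.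
      Poly_Mapping.single (m s t (m u v w)) 1) e) d) c) b) a"
    unfolding r1
    by (subst linear_trilin_ext[OF trilin_ext_linear(3)]) (simp add: trilin_ext_def simps)
  show "trilin_ext m (trilin_ext m a b c) d e = trilin_ext m a (trilin_ext m b c d) e"
    unfolding l c assms(1) ..
  show "trilin_ext m a (trilin_ext m b c d) e = trilin_ext m a b (trilin_ext m c d e)"
    unfolding c r assms(2) ..
qed

definition word_tp :: "(nat list \<Rightarrow>\<^sub>0 'k::field) \<Rightarrow> (nat list \<Rightarrow>\<^sub>0 'k) \<Rightarrow> (nat list \<Rightarrow>\<^sub>0 'k) \<Rightarrow>
    (nat list \<Rightarrow>\<^sub>0 'k)" where
  "word_tp = trilin_ext (\<lambda>u v w. u @ v @ w)"

lemma assoc_triple_system_word_tp: "assoc_triple_system pm_scale word_tp"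
  unfolding assoc_triple_system_def assoc_triple_system_axioms_def word_tp_def
  by (intro conjI allI vector_space_pm_scale trilin_ext_linear trilin_ext_assoc) simp_all

fun eval_word :: "('v::ab_group_add \<Rightarrow> 'v \<Rightarrow> 'v \<Rightarrow> 'v) \<Rightarrow> (nat \<Rightarrow> 'v) \<Rightarrow> nat list \<Rightarrow> 'v" where
  "eval_word tp \<rho> [] = 0"
| "eval_word tp \<rho> [i] = \<rho> i"
| "eval_word tp \<rho> (i # j # w) = tp (\<rho> i) (\<rho> j) (eval_word tp \<rho> w)"

lemma keys_lin_ext_subset: "Poly_Mapping.keys (lin_ext pm_scale h f) \<subseteq> (\<Union>t\<in>Poly_Mapping.keys f. Poly_Mapping.keys (h t))"
proof -
  have "Poly_Mapping.keys (lin_ext pm_scale h f) \<subseteq>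
      (\<Union>t\<in>Poly_Mapping.keys f. Poly_Mapping.keys (pm_scale (Poly_Mapping.lookup f t) (h t)))"
    unfolding lin_ext_def by (rule keys_sum)
  also have "\<dots> \<subseteq> (\<Union>t\<in>Poly_Mapping.keys f. Poly_Mapping.keys (h t))"
    by (intro UN_mono keys_pm_scale order_refl)
  finally show ?thesis .
qed

lemma keys_word_tp:
  "Poly_Mapping.keys (word_tp (f :: nat list \<Rightarrow>\<^sub>0 'a::field) g h) \<subseteq>
    {u @ v @ w | u v w. u \<in> Poly_Mapping.keys f \<and> v \<in> Poly_Mapping.keys g \<and> w \<in> Poly_Mapping.keys h}"
proof -
  have "Poly_Mapping.keys (word_tp f g h) \<subseteq>
      (\<Union>u\<in>Poly_Mapping.keys f. \<Union>v\<in>Poly_Mapping.keys g. \<Union>w\<in>Poly_Mapping.keys h.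
        Poly_Mapping.keys (Poly_Mapping.single (u @ v @ w) (1::'a)))"
    unfolding word_tp_def trilin_ext_def
    by (intro order_trans[OF keys_lin_ext_subset] UN_mono order_refl)
  also have "\<dots> \<subseteq> {u @ v @ w | u v w.
      u \<in> Poly_Mapping.keys f \<and> v \<in> Poly_Mapping.keys g \<and> w \<in> Poly_Mapping.keys h}"
    by auto
  finally show ?thesis .
qed

context assoc_triple_system
begin

lemma eval_word_append1:
  "odd (length v) \<Longrightarrow>
    eval_word tp \<rho> (i # v @ w) = tp (\<rho> i) (eval_word tp \<rho> v) (eval_word tp \<rho> w)"
  by (induction v arbitrary: i w rule: induct_list012) (auto simp: assoc_23)

lemma eval_word_append:
  "odd (length u) \<Longrightarrow> odd (length v) \<Longrightarrow>
    eval_word tp \<rho> (u @ v @ w) = tp (eval_word tp \<rho> u) (eval_word tp \<rho> v) (eval_word tp \<rho> w)"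
  by (induction u rule: induct_list012)
    (auto simp: assoc_23 assoc_12 eval_word_append1)

abbreviation odd_supp :: "(nat list \<Rightarrow>\<^sub>0 'k) \<Rightarrow> bool" where
  "odd_supp f \<equiv> (\<forall>w\<in>Poly_Mapping.keys f. odd (length w))"

lemma odd_supp_word_tp:
  "odd_supp f \<Longrightarrow> odd_supp g \<Longrightarrow> odd_supp h \<Longrightarrow> odd_supp (word_tp f g h)"
  using keys_word_tp[of f g h] by fastforce

lemma lin_ext_cong: "(\<And>t. t \<in> Poly_Mapping.keys f \<Longrightarrow> h t = h' t) \<Longrightarrow> lin_ext scale h f = lin_ext scale h' f"
  by (simp add: lin_ext_def)

lemma eval_word_tp:
  fixes \<rho> defines "F \<equiv> lin_ext scale (eval_word tp \<rho>)"
  assumes "odd_supp f" "odd_supp g" "odd_supp h"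
  shows "F (word_tp f g h) = tp (F f) (F g) (F h)"
proof -
  have F: "Vector_Spaces.linear pm_scale scale F"
    unfolding F_def by (rule linear_lin_ext) unfold_locales
  have single: "F (Poly_Mapping.single w 1) = eval_word tp \<rho> w" for w
    unfolding F_def by (rule lin_ext_single) unfold_locales
  have "F (word_tp f g h) = lin_ext scale (\<lambda>s. lin_ext scale (\<lambda>t. lin_ext scale (\<lambda>u.
      eval_word tp \<rho> (s @ t @ u)) h) g) f"
    unfolding word_tp_def linear_trilin_ext[OF F] single ..
  also have "\<dots> = lin_ext scale (\<lambda>s. lin_ext scale (\<lambda>t. lin_ext scale (\<lambda>u.
      tp (eval_word tp \<rho> s) (eval_word tp \<rho> t) (eval_word tp \<rho> u)) h) g) f"
    by (intro lin_ext_cong eval_word_append) (use assms in auto)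
  also have "\<dots> = tp (F f) (F g) (F h)"
    unfolding F_def
    by (simp add: linear_of_lin_ext[OF linear_1, symmetric]
        linear_of_lin_ext[OF linear_2, symmetric] linear_of_lin_ext[OF linear_3, symmetric])
  finally show ?thesis .
qed

lemma eval_monomial_word:
  fixes \<rho>
  defines "F \<equiv> lin_ext scale (eval_word tp \<rho>)"
    and "E \<equiv> eval_monomial (special_translator word_tp) (\<lambda>i. Poly_Mapping.single [i] 1)"
  shows "F (E t) = eval_monomial (special_translator tp) \<rho> t \<and> odd_supp (E t)"
proof (induction t)
  case (Var i)
  have "vector_space scale" by unfold_locales
  then show ?case by (simp add: E_def F_def lin_ext_single)
next
  case (Op s t u)
  have "Vector_Spaces.linear pm_scale scale F"
    unfolding F_def by (rule linear_lin_ext) unfold_locales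
  then interpret F: Vector_Spaces.linear pm_scale scale F .
  have E: "E (Op s t u) = word_tp (E s) (E t) (E u) - word_tp (E t) (E u) (E s)"
    by (simp add: E_def special_translator_def)
  have "Poly_Mapping.keys (E (Op s t u)) \<subseteq> Poly_Mapping.keys (word_tp (E s) (E t) (E u)) \<union> Poly_Mapping.keys (word_tp (E t) (E u) (E s))"
    unfolding E by (rule keys_diff)
  moreover have "odd_supp (word_tp (E s) (E t) (E u))" "odd_supp (word_tp (E t) (E u) (E s))"
    using Op by (intro odd_supp_word_tp; simp)+
  ultimately have "odd_supp (E (Op s t u))" by blast
  moreover have "F (E (Op s t u)) = eval_monomial (special_translator tp) \<rho> (Op s t u)"
    using Op eval_word_tp[of "E s" "E t" "E u" \<rho>] eval_word_tp[of "E t" "E u" "E s" \<rho>]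
    by (simp only: E F.diff eval_monomial.simps special_translator_def[of tp "eval_monomial _ _ s"]
        F_def[symmetric]) simp
  ultimately show ?case by blast
qed

end

lemma translator_identity_universal:
  fixes f :: "'k::field free_alg"
  assumes "translator_identity f"
  shows "translator_identity_on TYPE('v::ab_group_add) f"
  unfolding translator_identity_on_def
proof (intro allI impI)
  fix scale :: "'k \<Rightarrow> 'v \<Rightarrow> 'v" and tp \<rho>
  assume "assoc_triple_system scale tp"
  then interpret assoc_triple_system scale tp .
  let ?F = "lin_ext scale (eval_word tp \<rho>)"
  have F: "Vector_Spaces.linear pm_scale scale ?F"
    by (rule linear_lin_ext) unfold_locales
  then interpret F: Vector_Spaces.linear pm_scale scale ?F .
  have "eval_alg pm_scale (special_translator word_tp) (\<lambda>i. Poly_Mapping.single [i] 1) f = 0"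
    using assms assoc_triple_system_word_tp
    unfolding translator_identity_def translator_identity_on_def by blast
  hence "?F (eval_alg pm_scale (special_translator word_tp) (\<lambda>i. Poly_Mapping.single [i] 1) f) = 0"
    by simp
  thus "eval_alg scale (special_translator tp) \<rho> f = 0"
    by (simp add: eval_alg_def linear_of_lin_ext[OF F] eval_monomial_word)
qed

end

theory Submission
  imports Defs "HOL-Library.Multiset"
begin

text \<open>Write \<open>L a b c d e\<close>, \<open>M a b c d e\<close>, \<open>R a b c d e\<close> for the values of a linear functional
  \<open>\<phi>\<close> at \<open>\<langle>\<langle>a,b,c\<rangle>,d,e\<rangle>\<close>, \<open>\<langle>a,\<langle>b,c,d\<rangle>,e\<rangle>\<close> and \<open>\<langle>a,b,\<langle>c,d,e\<rangle>\<rangle>\<close>. If \<open>f\<close> did not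
  follow from the two identities, some \<open>\<phi>\<close> would vanish on all their consequences but not at \<open>f\<close>
  (\<open>separating_functional\<close>). The point is that every \<open>\<phi>\<close> vanishing on the consequences factors
  through the expansion of \<open>\<langle>x,y,z\<rangle> = xyz - yzx\<close> into words
  (\<open>functional_factors_through_words\<close>). As \<open>f\<close> expands to zero, \<open>\<phi> f = 0\<close>, a contradiction.

  To factor \<open>\<phi>\<close>, a function \<open>\<Psi>\<close> on words of length five is needed. Put
  \<open>D abcde = \<Psi> abcde - \<Psi> bcdea\<close>. The required equations for \<open>M\<close> and \<open>R\<close> read
  \<open>M a b c d e = D abcde - D acdbe\<close> and \<open>R a b c d e = D abcde - D abdec\<close>. For a fixed first letter
  they prescribe the increments of \<open>D\<close> along the edges of the Cayley graph of \<open>A\<^sub>4\<close> with respect to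
  two 3-cycles. This graph is a cuboctahedron; the increments cancel around its triangles by the cyclic
  identity in the inner operation and around its squares by the derivation identity, so \<open>D\<close> exists
  (\<open>closed_cochain_exact\<close>). To recover \<open>\<Psi>\<close> from \<open>D\<close> one needs the sum \<open>Z\<close> of \<open>D\<close> over
  the rotations of a word, whose fifth has to be subtracted from \<open>D\<close>, to be the same for all
  words of one parity. Now \<open>Z\<close> is invariant under rotations, and, with \<open>L\<close> expressed through
  \<open>M\<close> and \<open>R\<close> by the cyclic identity in the outer operation, the derivation identity becomes
  exactly \<open>Z abcde = Z adebc\<close>. The rotation and this exchange generate \<open>A\<^sub>5\<close>
  (\<open>word_function_of_relations\<close>).\<close>

section \<open>Functions on words from the two identities\<close>

text \<open>The steps \<open>b c d e \<rightarrow> c d b e\<close> and \<open>b c d e \<rightarrow> b d e c\<close> make the twelve even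
  arrangements of four letters the vertices of a cuboctahedron, the Cayley graph of \<open>A\<^sub>4\<close> for two
  3-cycles whose product is an involution. \<open>S\<close> and \<open>T\<close> prescribe the increments along the two
  kinds of edges. The hypotheses say that the increments cancel around the triangles and around the
  squares; these faces generate all cycles, so a potential exists.\<close>

lemma closed_cochain_exact:
  fixes S T :: "'b \<Rightarrow> 'b \<Rightarrow> 'b \<Rightarrow> 'b \<Rightarrow> 'k::field_char_0"
  assumes S3: "\<And>b c d e. S b c d e + S c d b e + S d b c e = 0"
    and T3: "\<And>b c d e. T b c d e + T b d e c + T b e c d = 0"
    and square: "\<And>b c d e. S b c d e + T c d b e + S c b e d + T b e c d = 0"
  obtains G where "\<And>b c d e. G b c d e - G c d b e = S b c d e"
    and "\<And>b c d e. G b c d e - G b d e c = T b c d e"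
proof -
  \<comment> \<open>Four potentials, each normalised on the words in which one chosen letter comes last, are
    averaged. If \<open>e\<close> is the chosen letter, \<open>C b c d e\<close> is the potential on the words
    ending in \<open>e\<close>, an \<open>S\<close>-triangle, on which its values sum to zero. The other three
    terms of \<open>F\<close> belong to the chosen letters \<open>d\<close>, \<open>c\<close> and \<open>b\<close>: each
    follows a path from \<open>b c d e\<close> to the word where \<open>C\<close> is evaluated, and \<open>H\<close>,
    for \<open>b\<close>, needs an \<open>S\<close>-step to bring \<open>b\<close> into the reach of \<open>T\<close>-steps.\<close>
  define C where "C b c d e = (S b c d e - S d b c e) / 3" for b c d e
  define H where "H b c d e = S b c d e + C c e d b - T c e d b" for b c d e
  define F where "F b c d e =
    C b c d e + (C b e c d - T b e c d) + (C b d e c + T b c d e) + H b c d e" for b c d e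
  have C: "C b c d e - C c d b e = S b c d e" for b c d e
  proof -
    have "C b c d e - C c d b e = (2 * S b c d e - (S c d b e + S d b c e)) / 3"
      by (simp add: C_def field_simps)
    also have "S c d b e + S d b c e = - S b c d e"
      using S3[of b c d e] by algebra
    finally show ?thesis by simp
  qed
  \<comment> \<open>Along a \<open>T\<close>-step, \<open>H\<close> needs two squares, while the other terms of \<open>F\<close> need only triangles;
    along an \<open>S\<close>-step, \<open>F\<close> needs two squares.\<close>
  have HT: "H b c d e - H b d e c = T b c d e" for b c d e
  proof -
    have "H b c d e - H b d e c - T b c d e =
        (S b c d e + S c d b e + S d b c e) + (T d b c e + T d c e b + T d e b c)
        - (S b d e c + T d e b c + S d b c e + T b c d e)
        - (S c d b e + T d b c e + S d c e b + T c e d b)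
        - (C d c e b - C c e d b - S d c e b)"
      by (simp add: H_def)
    also have "\<dots> = 0"
      by (simp only: S3 T3 square C) simp
    finally show ?thesis by simp
  qed
  have FS: "F b c d e - F c d b e = 4 * S b c d e" for b c d e
  proof -
    have "F b c d e - F c d b e - 4 * S b c d e =
        (C b c d e - C c d b e - S b c d e) - (C c b e d - C b e c d - S c b e d)
        + (C b d e c - C d e b c - S b d e c)
        + (S d b c e + T b c d e + S b d e c + T d e b c)
        - (S c b e d + T b e c d + S b c d e + T c d b e)
        - (S b c d e + S c d b e + S d b c e)"
      by (simp add: F_def H_def)
    also have "\<dots> = 0"
      by (simp only: S3 square C) simp
    finally show ?thesis by simp
  qed
  have FT: "F b c d e - F b d e c = 4 * T b c d e" for b c d e
  proof -
    have "F b c d e - F b d e c - 4 * T b c d e =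
        (H b c d e - H b d e c - T b c d e) - (T b c d e + T b d e c + T b e c d)"
      by (simp add: F_def)
    also have "\<dots> = 0"
      by (simp only: HT T3) simp
    finally show ?thesis by simp
  qed
  show ?thesis
    by (rule that[of "\<lambda>b c d e. F b c d e / 4"])
      (simp_all add: diff_divide_distrib[symmetric] FS FT)
qed

text \<open>The conclusion says that \<open>L\<close>, \<open>M\<close> and \<open>R\<close> are the values of one function on words at
  the expansions of \<open>\<langle>\<langle>a,b,c\<rangle>,d,e\<rangle>\<close>, \<open>\<langle>a,\<langle>b,c,d\<rangle>,e\<rangle>\<close> and \<open>\<langle>a,b,\<langle>c,d,e\<rangle>\<rangle>\<close>.
  In each of these expansions the inner operation takes a difference under a 3-cycle of positions and
  the outer one a difference under a rotation. The two are inverted in turn: first the 3-cycles, which for \<open>M\<close> and \<open>R\<close> fix the first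
  letter and so reduce to \<open>closed_cochain_exact\<close>, then the rotation, for which the cyclic sums
  have to be invariant under those 3-cycles.\<close>

lemma word_function_of_relations:
  fixes L M R :: "'b \<Rightarrow> 'b \<Rightarrow> 'b \<Rightarrow> 'b \<Rightarrow> 'b \<Rightarrow> 'k::field_char_0"
  assumes M3: "\<And>a b c d e. M a b c d e + M a c d b e + M a d b c e = 0"
    and R3: "\<And>a b c d e. R a b c d e + R a b d e c + R a b e c d = 0"
    and outer: "\<And>a b c d e. L a b c d e + R d e a b c + M e a b c d = 0"
    and der: "\<And>a b c d e. L a b c d e = L a d e b c + M a b d e c + R a b c d e"
  obtains \<Psi> where
      "\<And>a b c d e. L a b c d e = \<Psi> [a,b,c,d,e] - \<Psi> [b,c,a,d,e] - \<Psi> [d,e,a,b,c] + \<Psi> [d,e,b,c,a]"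
    and "\<And>a b c d e. M a b c d e = \<Psi> [a,b,c,d,e] - \<Psi> [a,c,d,b,e] - \<Psi> [b,c,d,e,a] + \<Psi> [c,d,b,e,a]"
    and "\<And>a b c d e. R a b c d e = \<Psi> [a,b,c,d,e] - \<Psi> [a,b,d,e,c] - \<Psi> [b,c,d,e,a] + \<Psi> [b,d,e,c,a]"
proof -
  \<comment> \<open>With the first letter fixed, \<open>der\<close> says that two adjacent increments of a square add up to
    \<open>L a b e c d - L a c d b e\<close>. The other two are obtained by exchanging \<open>b, e\<close> with \<open>c, d\<close>,
    which negates this difference, so the squares close.\<close>
  have "\<exists>G. (\<forall>b c d e. G b c d e - G c d b e = M a b c d e) \<and>
      (\<forall>b c d e. G b c d e - G b d e c = R a b c d e)" for a
  proof -
    have "M a b c d e + R a c d b e + M a c b e d + R a b e c d = 0" for b c d e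
      using der[of a b e c d] der[of a c d b e] by algebra
    from closed_cochain_exact[of "M a" "R a", OF M3 R3 this]
    show ?thesis by metis
  qed
  then obtain D where DM: "\<And>a b c d e. D a b c d e - D a c d b e = M a b c d e"
    and DR: "\<And>a b c d e. D a b c d e - D a b d e c = R a b c d e"
    by metis
  \<comment> \<open>\<open>D\<close> would be a difference \<open>\<Psi> - \<Psi> \<circ> rotation\<close> if its cyclic sums \<open>Z\<close> vanished. It is
    enough that \<open>Z\<close> depends only on the parity of the word.\<close>
  define Z where "Z a b c d e = D a b c d e + D b c d e a + D c d e a b + D d e a b c + D e a b c d"
    for a b c d e
  have rot: "Z a b c d e = Z b c d e a" for a b c d e
    by (simp add: Z_def)
  \<comment> \<open>After elimination of \<open>L\<close> by \<open>outer\<close>, the ten terms of \<open>der\<close> are two full cyclic sums.\<close>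
  have swap: "Z a b c d e = Z a d e b c" for a b c d e
    using der[of a b c d e] outer[of a b c d e] outer[of a d e b c]
    unfolding Z_def DM[symmetric] DR[symmetric] by algebra
  \<comment> \<open>Two rotations, an exchange and a rotation compose to the first 3-cycle; a rotation, an
    exchange and two rotations to the second.\<close>
  have ZR: "Z a b c d e = Z a b d e c" for a b c d e
    by (metis rot swap)
  have ZM: "Z a b c d e = Z a c d b e" for a b c d e
    by (metis rot swap)
  \<comment> \<open>The weights 4, 3, 2, 1, 0 along the rotations make the difference of \<open>P\<close> under one
    rotation equal to \<open>D\<close> minus the mean of \<open>D\<close> over the rotations; this mean cancels in
    the differences of \<open>D\<close> that give \<open>M\<close> and \<open>R\<close>.\<close>
  define P where "P a b c d e = (4 * D a b c d e + 3 * D b c d e a + 2 * D c d e a b + D d e a b c) / 5"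
    for a b c d e
  have P: "P a b c d e - P b c d e a = D a b c d e - Z a b c d e / 5" for a b c d e
    by (simp add: P_def Z_def field_simps)
  define \<Psi> where "\<Psi> w = P (w!0) (w!1) (w!2) (w!3) (w!4)" for w
  have \<Psi>: "\<Psi> [a,b,c,d,e] = P a b c d e" for a b c d e
    by (simp add: \<Psi>_def)
  have 1: "M a b c d e = P a b c d e - P a c d b e - P b c d e a + P c d b e a" for a b c d e
    using P[of a b c d e] P[of a c d b e] ZM[of a b c d e] DM[of a b c d e] by algebra
  have 2: "R a b c d e = P a b c d e - P a b d e c - P b c d e a + P b d e c a" for a b c d e
    using P[of a b c d e] P[of a b d e c] ZR[of a b c d e] DR[of a b c d e] by algebra
  have 3: "L a b c d e = P a b c d e - P b c a d e - P d e a b c + P d e b c a" for a b c d e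
    using 1[of e a b c d] 2[of d e a b c] outer[of a b c d e] by algebra
  show thesis
    by (rule that[of \<Psi>]) (simp_all only: \<Psi> 1[symmetric] 2[symmetric] 3[symmetric])
qed

section \<open>Linear maps on the free algebra\<close>

lemma linear_add: "Vector_Spaces.linear s1 s2 F \<Longrightarrow> F (x + y) = F x + F y"
  by (simp add: module_hom_iff_linear[symmetric] module_hom_iff)

lemma linear_diff: "Vector_Spaces.linear s1 s2 F \<Longrightarrow> F (x - y) = F x - F y"
  using module_hom.diff by (auto simp: module_hom_iff_linear[symmetric])

lemma br_add:
  "br (f + f') g h = br f g h + br f' g h"
  "br f (g + g') h = br f g h + br f g' h"
  "br f g (h + h') = br f g h + br f g h'"
  unfolding br_def by (rule trilin_ext_linear[THEN linear_add])+

lemma br_mon: "br (mon s) (mon t) (mon u) = mon (Op s t u)"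
  by (simp add: br_def trilin_ext_def mon_def lin_ext_single[OF vector_space_pm_scale])

lemma linear_subst: "Vector_Spaces.linear pm_scale pm_scale (subst \<sigma>)"
  unfolding subst_def by (rule linear_pm_lin_ext)

lemma subst_mon: "subst \<sigma> (mon t) = mon (subst_monomial \<sigma> t)"
  by (simp add: subst_def mon_def lin_ext_single[OF vector_space_pm_scale])

lemma subst_arith:
  "subst \<sigma> (f + g) = subst \<sigma> f + subst \<sigma> g"
  "subst \<sigma> (f - g) = subst \<sigma> f - subst \<sigma> g"
proof -
  interpret Vector_Spaces.linear pm_scale pm_scale "subst \<sigma>" by (rule linear_subst)
  show "subst \<sigma> (f + g) = subst \<sigma> f + subst \<sigma> g"
    "subst \<sigma> (f - g) = subst \<sigma> f - subst \<sigma> g"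
    by (rule add diff)+
qed

lemma multilinear_arith:
  assumes "multilinear X f" "multilinear X g"
  shows "multilinear X (f + g)" "multilinear X (f - g)"
  using assms keys_add[of f g] keys_diff[of f g] by (auto simp: multilinear_def)

lemma multilinear_mon: "multilinear_monomial X t \<Longrightarrow> multilinear X (mon t)"
  by (simp add: multilinear_def mon_def)

lemma lin_ext_mon: "lin_ext pm_scale mon f = f"
proof (rule poly_mapping_eqI)
  fix t
  have "Poly_Mapping.lookup (lin_ext pm_scale mon f) t =
      (\<Sum>s\<in>Poly_Mapping.keys f. Poly_Mapping.lookup f s * (if s = t then 1 else 0))"
    by (simp add: lin_ext_def lookup_sum lookup_pm_scale mon_def lookup_single when_def)
  also have "\<dots> = (\<Sum>s\<in>Poly_Mapping.keys f. if s = t then Poly_Mapping.lookup f s else 0)"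
    by (rule sum.cong) auto
  finally show "Poly_Mapping.lookup (lin_ext pm_scale mon f) t = Poly_Mapping.lookup f t"
    by (simp add: in_keys_iff)
qed

lemma vector_space_field: "vector_space ((*) :: 'k::field \<Rightarrow> 'k \<Rightarrow> 'k)"
  by unfold_locales (simp_all add: algebra_simps)

text \<open>Membership in an operadic ideal is a statement about a subspace; functionals turn it into
  linear equations between scalars.\<close>

lemma separating_functional:
  fixes scale :: "'k::field \<Rightarrow> 'v::ab_group_add \<Rightarrow> 'v"
  assumes "vector_space scale" "module.subspace scale W" "x \<notin> W"
  obtains \<phi> where "Vector_Spaces.linear scale (*) \<phi>" "\<And>w. w \<in> W \<Longrightarrow> \<phi> w = 0" "\<phi> x \<noteq> 0"
proof -
  interpret V: vector_space scale by fact
  interpret P: vector_space_pair scale "(*) :: 'k \<Rightarrow> 'k \<Rightarrow> 'k"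
    by (intro vector_space_pair.intro vector_space_field assms(1))
  obtain B where B: "B \<subseteq> W" "V.independent B" "W \<subseteq> V.span B"
    using V.maximal_independent_subset by blast
  then have "V.span B = W"
    using assms(2) by (simp add: V.span_minimal subset_antisym)
  then have x: "x \<notin> V.span B" "x \<notin> B" "V.independent (insert x B)"
    using assms(3) B V.span_superset by (auto simp: V.independent_insert)
  from P.linear_independent_extend[OF x(3), of "\<lambda>y. if y = x then 1 else 0"]
  obtain \<phi> where \<phi>: "Vector_Spaces.linear scale (*) \<phi>"
      "\<forall>y\<in>insert x B. \<phi> y = (if y = x then 1 else 0)"
    by blast
  show thesis
  proof (rule that)
    show "Vector_Spaces.linear scale (*) \<phi>" by fact
    show "\<phi> x \<noteq> 0" using \<phi>(2) by simp
    show "\<phi> w = 0" if "w \<in> W" for w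
    proof (rule P.linear_eq_0_on_span[OF \<phi>(1)])
      show "\<phi> y = 0" if "y \<in> B" for y
        using \<phi>(2) x(2) that by auto
      show "w \<in> V.span B"
        using that \<open>V.span B = W\<close> by simp
    qed
  qed
qed

lemma subspace_operadic_ideal:
  assumes "finite X"
  shows "module.subspace pm_scale {f. operadic_ideal G X f}"
proof -
  interpret vector_space "pm_scale :: 'a \<Rightarrow> _" by (rule vector_space_pm_scale)
  show ?thesis
    by (auto simp: subspace_def intro: assms operadic_ideal.intros)
qed

section \<open>Consequences of the cyclic and derivation identities\<close>

abbreviation consequence :: "nat set \<Rightarrow> 'k::field free_alg \<Rightarrow> bool" where
  "consequence \<equiv> operadic_ideal {cyclic_identity, derivation_identity}"

lemma consequence_cyclic:
  assumes "multilinear_monomial X r" "multilinear_monomial Y s" "multilinear_monomial Z t"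
    and "X \<inter> Y = {}" "X \<inter> Z = {}" "Y \<inter> Z = {}" "V = X \<union> Y \<union> Z"
  shows "consequence V (mon (Op r s t) + mon (Op s t r) + mon (Op t r s))"
proof -
  let ?\<sigma> = "(!) [r, s, t]" and ?Y = "(!) [X, Y, Z]"
  have 0: "multilinear {0,1,2} cyclic_identity"
    unfolding cyclic_identity_def Let_def br_mon
    by (intro multilinear_arith multilinear_mon) (auto simp: multilinear_monomial_def)
  have "consequence {0,1,2} cyclic_identity"
    by (rule operadic_ideal.generator) (use 0 in auto)
  then have "consequence (\<Union>x\<in>{0,1,2}. ?Y x) (subst ?\<sigma> cyclic_identity)"
    by (rule operadic_ideal.subst) (use assms in auto)
  then show ?thesis
    using assms(7) by (simp add: cyclic_identity_def br_mon subst_mon subst_arith Un_assoc)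
qed

lemma consequence_derivation:
  assumes "distinct [a,b,c,d,e]" "V = {a,b,c,d,e}"
  defines "v \<equiv> Var a" and "w \<equiv> Var b" and "x \<equiv> Var c" and "y \<equiv> Var d" and "z \<equiv> Var e"
  shows "consequence V (mon (Op (Op v w x) y z) -
    (mon (Op (Op v y z) w x) + mon (Op v (Op w y z) x) + mon (Op v w (Op x y z))))"
proof -
  let ?\<sigma> = "\<lambda>i. Var ([a,b,c,d,e] ! i)" and ?Y = "\<lambda>i. {[a,b,c,d,e] ! i}"
  have 0: "multilinear {0,1,2,3,4} derivation_identity"
    unfolding derivation_identity_def Let_def br_mon
    by (intro multilinear_arith multilinear_mon) (auto simp: multilinear_monomial_def)
  have "consequence {0,1,2,3,4} derivation_identity"
    by (rule operadic_ideal.generator) (use 0 in auto)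
  then have "consequence (\<Union>x\<in>{0,1,2,3,4}. ?Y x) (subst ?\<sigma> derivation_identity)"
    by (rule operadic_ideal.subst) (use assms in \<open>auto simp: multilinear_monomial_def\<close>)
  then show ?thesis
    using assms by (simp add: derivation_identity_def br_mon subst_mon subst_arith insert_commute)
qed

lemma consequence_cyclic_inner:
  assumes "distinct [a,b,c,d,e]" "V = {a,b,c,d,e}"
  shows "consequence V (mon (Op (Var a) (Op (Var b) (Var c) (Var d)) (Var e)) +
      mon (Op (Var a) (Op (Var c) (Var d) (Var b)) (Var e)) +
      mon (Op (Var a) (Op (Var d) (Var b) (Var c)) (Var e)))" (is ?M)
    and "consequence V (mon (Op (Var a) (Var b) (Op (Var c) (Var d) (Var e))) +
      mon (Op (Var a) (Var b) (Op (Var d) (Var e) (Var c))) +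
      mon (Op (Var a) (Var b) (Op (Var e) (Var c) (Var d))))" (is ?R)
proof -
  have var: "multilinear_monomial {i} (Var i)" for i
    by (simp add: multilinear_monomial_def)
  have "consequence {b,c,d} (mon (Op (Var b) (Var c) (Var d)) + mon (Op (Var c) (Var d) (Var b))
      + mon (Op (Var d) (Var b) (Var c)))"
    by (rule consequence_cyclic[OF var var var]) (use assms in auto)
  from operadic_ideal.insert_2[OF this var[of a] var[of e]] show ?M
    using assms by (auto simp: br_add br_mon insert_commute)
  have "consequence {c,d,e} (mon (Op (Var c) (Var d) (Var e)) + mon (Op (Var d) (Var e) (Var c))
      + mon (Op (Var e) (Var c) (Var d)))"
    by (rule consequence_cyclic[OF var var var]) (use assms in auto)
  from operadic_ideal.insert_3[OF this var[of a] var[of b]] show ?R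
    using assms by (auto simp: br_add br_mon insert_commute)
qed

lemma consequence_cyclic_outer:
  assumes "distinct [a,b,c,d,e]" "V = {a,b,c,d,e}"
  shows "consequence V (mon (Op (Op (Var a) (Var b) (Var c)) (Var d) (Var e)) +
    mon (Op (Var d) (Var e) (Op (Var a) (Var b) (Var c))) +
    mon (Op (Var e) (Op (Var a) (Var b) (Var c)) (Var d)))"
  by (rule consequence_cyclic[of "{a,b,c}" _ "{d}" _ "{e}"])
    (use assms in \<open>auto simp: multilinear_monomial_def\<close>)

section \<open>Monomials of degree five and their expansions\<close>

lemma word_tp_diff:
  "word_tp (f - f') g h = word_tp f g h - word_tp f' g h"
  "word_tp f (g - g') h = word_tp f g h - word_tp f g' h"
  "word_tp f g (h - h') = word_tp f g h - word_tp f g h'"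
  unfolding word_tp_def by (rule trilin_ext_linear[THEN linear_diff])+

lemma word_tp_single:
  "word_tp (Poly_Mapping.single u 1) (Poly_Mapping.single v 1) (Poly_Mapping.single w 1)
    = Poly_Mapping.single (u @ v @ w) 1"
  by (simp add: word_tp_def trilin_ext_def lin_ext_single[OF vector_space_pm_scale])

lemma odd_length_vars: "odd (length (vars t))"
  by (induction t) auto

lemma length_vars_eq_1: "length (vars t) = 1 \<Longrightarrow> \<exists>a. t = Var a"
  by (cases t) (use odd_length_vars in \<open>auto simp: add_is_1 dest: odd_pos\<close>)

lemma length_vars_eq_3:
  assumes "length (vars t) = 3"
  shows "\<exists>a b c. t = Op (Var a) (Var b) (Var c)"
proof (cases t)
  case (Op r s u)
  have "length (vars r) = 1" "length (vars s) = 1" "length (vars u) = 1"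
    using assms unfolding Op vars.simps length_append
    using odd_pos[OF odd_length_vars[of r]] odd_pos[OF odd_length_vars[of s]]
      odd_pos[OF odd_length_vars[of u]] by linarith+
  then show ?thesis
    using Op by (blast dest: length_vars_eq_1)
qed (use assms in simp)

lemma length_vars_eq_5:
  assumes "length (vars t) = 5"
  obtains (left) a b c d e where "t = Op (Op (Var a) (Var b) (Var c)) (Var d) (Var e)"
  | (middle) a b c d e where "t = Op (Var a) (Op (Var b) (Var c) (Var d)) (Var e)"
  | (right) a b c d e where "t = Op (Var a) (Var b) (Op (Var c) (Var d) (Var e))"
proof (cases t)
  case (Op r s u)
  have odd: "odd (length (vars r))" "odd (length (vars s))" "odd (length (vars u))"
    by (rule odd_length_vars)+
  have sum: "length (vars r) + length (vars s) + length (vars u) = 5"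
    using assms Op by simp
  have "length (vars r) = 3 \<and> length (vars s) = 1 \<and> length (vars u) = 1
    \<or> length (vars r) = 1 \<and> length (vars s) = 3 \<and> length (vars u) = 1
    \<or> length (vars r) = 1 \<and> length (vars s) = 1 \<and> length (vars u) = 3"
    using odd sum by presburger
  then show ?thesis
    using that Op by (elim disjE conjE) (metis length_vars_eq_1 length_vars_eq_3)+
qed (use assms in simp)

text \<open>Expressing multilinearity by multisets makes its invariance under permutations of the letters
  a matter of rewriting.\<close>

lemma mset_eq_mset_set_iff:
  assumes "finite X"
  shows "mset xs = mset_set X \<longleftrightarrow> distinct xs \<and> set xs = X"
proof
  assume eq: "mset xs = mset_set X"
  then have "set xs = X"
    using assms by (metis finite_set_mset_mset_set set_mset_mset)
  then show "distinct xs \<and> set xs = X"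
    using assms by (simp add: distinct_count_atmost_1 eq count_mset_set)
qed (use assms in \<open>auto simp: mset_set_set\<close>)

section \<open>Factorisation through words\<close>

text \<open>A functional that vanishes on the consequences of the two identities sees a monomial only
  through its expansion into words: its values on the three bracketings satisfy the relations of
  \<open>word_function_of_relations\<close>.\<close>

lemma functional_factors_through_words:
  fixes \<phi> :: "'k::field_char_0 free_alg \<Rightarrow> 'k"
  assumes lin: "Vector_Spaces.linear pm_scale (*) \<phi>"
    and zero: "\<And>g. consequence {..<5} g \<Longrightarrow> \<phi> g = 0"
  obtains \<psi> where "Vector_Spaces.linear pm_scale (*) \<psi>"
    and "\<And>t. multilinear_monomial {..<5} t \<Longrightarrow>
      \<psi> (eval_monomial (special_translator word_tp) (\<lambda>i. Poly_Mapping.single [i] 1) t) = \<phi> (mon t)"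
proof -
  \<comment> \<open>Extension by zero outside the multilinear monomials makes the relations hold for all
    quintuples, including those with repeated letters.\<close>
  define \<chi> where "\<chi> t = (if mset (vars t) = mset_set {..<5} then \<phi> (mon t) else 0)" for t
  define L where "L a b c d e = \<chi> (Op (Op (Var a) (Var b) (Var c)) (Var d) (Var e))" for a b c d e
  define M where "M a b c d e = \<chi> (Op (Var a) (Op (Var b) (Var c) (Var d)) (Var e))" for a b c d e
  define R where "R a b c d e = \<chi> (Op (Var a) (Var b) (Op (Var c) (Var d) (Var e)))" for a b c d e
  note defs = L_def M_def R_def \<chi>_def
  have good: "distinct [a,b,c,d,e]" "{..<5} = {a,b,c,d,e}"
    if "{#a,b,c,d,e#} = mset_set {..<5}" for a b c d e :: nat
    using that mset_eq_mset_set_iff[of "{..<5}" "[a,b,c,d,e]"] by simp_all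
  have M3: "M a b c d e + M a c d b e + M a d b c e = 0" for a b c d e
  proof (cases "{#a,b,c,d,e#} = mset_set {..<5}")
    case True
    from zero[OF consequence_cyclic_inner(1)[OF good[OF True]]] True show ?thesis
      by (simp add: defs linear_add[OF lin] add_mset_commute)
  qed (simp add: defs add_mset_commute)
  have R3: "R a b c d e + R a b d e c + R a b e c d = 0" for a b c d e
  proof (cases "{#a,b,c,d,e#} = mset_set {..<5}")
    case True
    from zero[OF consequence_cyclic_inner(2)[OF good[OF True]]] True show ?thesis
      by (simp add: defs linear_add[OF lin] add_mset_commute)
  qed (simp add: defs add_mset_commute)
  have outer: "L a b c d e + R d e a b c + M e a b c d = 0" for a b c d e
  proof (cases "{#a,b,c,d,e#} = mset_set {..<5}")
    case True
    from zero[OF consequence_cyclic_outer[OF good[OF True]]] True show ?thesis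
      by (simp add: defs linear_add[OF lin] add_mset_commute)
  qed (simp add: defs add_mset_commute)
  have der: "L a b c d e = L a d e b c + M a b d e c + R a b c d e" for a b c d e
  proof (cases "{#a,b,c,d,e#} = mset_set {..<5}")
    case True
    from zero[OF consequence_derivation[OF good[OF True]]] True show ?thesis
      by (simp add: defs linear_add[OF lin] linear_diff[OF lin] add_mset_commute)
  qed (simp add: defs add_mset_commute)
  obtain \<Psi> where \<Psi>:
    "\<And>a b c d e. L a b c d e = \<Psi> [a,b,c,d,e] - \<Psi> [b,c,a,d,e] - \<Psi> [d,e,a,b,c] + \<Psi> [d,e,b,c,a]"
    "\<And>a b c d e. M a b c d e = \<Psi> [a,b,c,d,e] - \<Psi> [a,c,d,b,e] - \<Psi> [b,c,d,e,a] + \<Psi> [c,d,b,e,a]"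
    "\<And>a b c d e. R a b c d e = \<Psi> [a,b,c,d,e] - \<Psi> [a,b,d,e,c] - \<Psi> [b,c,d,e,a] + \<Psi> [b,d,e,c,a]"
    by (fact word_function_of_relations[OF M3 R3 outer der])
  define \<psi> where "\<psi> = lin_ext (*) \<Psi>"
  have lin_\<psi>: "Vector_Spaces.linear pm_scale (*) \<psi>"
    unfolding \<psi>_def by (rule linear_lin_ext[OF vector_space_field])
  have \<psi>_word: "\<psi> (Poly_Mapping.single w 1) = \<Psi> w" for w
    unfolding \<psi>_def by (rule lin_ext_single[OF vector_space_field])
  show thesis
  proof (rule that[OF lin_\<psi>])
    fix t
    assume "multilinear_monomial {..<5} t"
    then have t: "mset (vars t) = mset_set {..<5}"
      by (simp add: multilinear_monomial_def mset_eq_mset_set_iff)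
    then have "length (vars t) = 5"
      by (metis card_lessThan size_mset size_mset_set)
    then show "\<psi> (eval_monomial (special_translator word_tp) (\<lambda>i. Poly_Mapping.single [i] 1) t)
        = \<phi> (mon t)"
    proof (cases rule: length_vars_eq_5)
      case (left a b c d e)
      then have "\<phi> (mon t) = L a b c d e"
        using t by (simp add: L_def \<chi>_def)
      then show ?thesis
        by (simp add: left \<Psi> special_translator_def word_tp_diff word_tp_single
            linear_diff[OF lin_\<psi>] \<psi>_word)
    next
      case (middle a b c d e)
      then have "\<phi> (mon t) = M a b c d e"
        using t by (simp add: M_def \<chi>_def)
      then show ?thesis
        by (simp add: middle \<Psi> special_translator_def word_tp_diff word_tp_single
            linear_diff[OF lin_\<psi>] \<psi>_word)
    next
      case (right a b c d e)
      then have "\<phi> (mon t) = R a b c d e"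
        using t by (simp add: R_def \<chi>_def)
      then show ?thesis
        by (simp add: right \<Psi> special_translator_def word_tp_diff word_tp_single
            linear_diff[OF lin_\<psi>] \<psi>_word)
    qed
  qed
qed

theorem lemma5p3:
  fixes f :: "'k::field_char_0 free_alg"
  assumes "multilinear {..<5} f"
    and "translator_identity f"
  shows "operadic_ideal {cyclic_identity, derivation_identity} {..<5} f"
proof (rule ccontr)
  assume "\<not> consequence {..<5} f"
  then obtain \<phi> :: "'k free_alg \<Rightarrow> 'k" where lin_\<phi>: "Vector_Spaces.linear pm_scale (*) \<phi>"
      and zero: "\<And>g. consequence {..<5} g \<Longrightarrow> \<phi> g = 0" and nonzero: "\<phi> f \<noteq> 0"
    using separating_functional[OF vector_space_pm_scale subspace_operadic_ideal, of "{..<5}" f]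
    by (metis finite_lessThan mem_Collect_eq)
  let ?E = "eval_monomial (special_translator word_tp) (\<lambda>i. Poly_Mapping.single [i] (1::'k))"
  obtain \<psi> where lin_\<psi>: "Vector_Spaces.linear pm_scale (*) \<psi>"
      and \<psi>: "\<And>t. multilinear_monomial {..<5} t \<Longrightarrow> \<psi> (?E t) = \<phi> (mon t)"
    using functional_factors_through_words[OF lin_\<phi> zero] by metis
  \<comment> \<open>The identity is tested on the generators of the word system.\<close>
  have "lin_ext pm_scale ?E f = 0"
    using assms(2) assoc_triple_system_word_tp
    unfolding translator_identity_def translator_identity_on_def eval_alg_def by blast
  then have "0 = \<psi> (lin_ext pm_scale ?E f)"
    using linear_diff[OF lin_\<psi>, of 0 0] by simp
  also have "\<dots> = lin_ext (*) (\<lambda>t. \<psi> (?E t)) f"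
    by (rule linear_of_lin_ext[OF lin_\<psi>])
  also have "\<dots> = lin_ext (*) (\<lambda>t. \<phi> (mon t)) f"
    using assms(1) \<psi> by (simp add: lin_ext_def multilinear_def)
  also have "\<dots> = \<phi> f"
    by (simp add: linear_of_lin_ext[OF lin_\<phi>, symmetric] lin_ext_mon)
  finally show False
    using nonzero by simp
qed

end
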